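(* Let $k\ge1$, $h_{\max}\in\mathbb{R}$ and ${\bf x}_0,{\bf x}_T\in\mathbb{R}^k$, and consider the time-optimal problem (P) described in the context, in which the state constraint is imposed on the first coordinate ($s=1$). Let $(\bar{\bf x}(\cdot),\bar u(\cdot),\bar T)$ be a solution to (P), and put $$\Sigma=\{t\in[0,\bar T]:\ \bar x_1(t)=h_{\max}\},\qquad \Sigma_0=\{t\in\Sigma:\ \bar x_i(t)=0,\ i=2,\dots,k\}.$$ Then $\Sigma$ is either finite, or it can be represented as $\Sigma=\Sigma'\cup\{\sigma\}$, where $\Sigma'$ is a countably infinite set consisting of isolated points and $\sigma$ is the limit point of $\Sigma'$. Moreover, the set $\Sigma_0$ is either empty or a singleton.
   Context: Problem (P): minimize $T$ over triples $({\bf x}(\cdot),u(\cdot),T)$, $T>0$ free, where $u\in L_\infty([0,T];\mathbb{R})$, $|u(t)|\le 1$ for a.e. $t\in[0,T]$, ${\bf x}=(x_1,\dots,x_k):[0,T]\to\mathbb{R}^k$ is absolutely continuous, $\dot x_i=x_{i+1}$ for $i=1,\dots,k-1$, $\dot x_k=u$ (a.e.), ${\bf x}(0)={\bf x}_0$, ${\bf x}(T)={\bf x}_T$, and $x_1(t)\le h_{\max}$ for all $t\in[0,T]$. (The original problem has bounds $x_i(t)\in[h^i_{\min},h^i_{\max}]$ for all $i$; it is assumed that only $x_1\le h_{\max}=h^1_{\max}$ can be active, all other bounds being so large in absolute value that they are nowhere active, so they play no role.) Triples satisfying all these constraints are called feasible processes; the set of feasible processes is assumed non-empty. A solution is a feasible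 process whose time $\bar T$ is minimal among all feasible processes (global minimum). Standing assumption on the solution: $\bar x_1(0)<h_{\max}$ and $\bar x_1(\bar T)<h_{\max}$. *)

theory Defs
  imports "HOL-Analysis.Analysis"
begin

definition absolutely_continuous_on :: "real set \<Rightarrow> (real \<Rightarrow> real) \<Rightarrow> bool" where
  "absolutely_continuous_on S f \<longleftrightarrow>
    (\<forall>\<epsilon>>0. \<exists>\<delta>>0. \<forall>(n::nat) a b.
      (\<forall>j<n. a j \<le> b j \<and> {a j..b j} \<subseteq> S) \<and>
      disjoint_family_on (\<lambda>j. {a j<..<b j}) {..<n} \<and>
      (\<Sum>j<n. b j - a j) < \<delta>
      \<longrightarrow> (\<Sum>j<n. \<bar>f (b j) - f (a j)\<bar>) < \<epsilon>)"

(* Vectors of R^k are functions nat => real of which only the components 1..k matter;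
   x t i is the i-th component of the state at time t. Only times in {0..T} matter.
   Membership of u in L_infinity is measurability together with the a.e. bound 1. *)
definition feasible_process ::
  "nat \<Rightarrow> real \<Rightarrow> (nat \<Rightarrow> real) \<Rightarrow> (nat \<Rightarrow> real) \<Rightarrow>
   (real \<Rightarrow> nat \<Rightarrow> real) \<Rightarrow> (real \<Rightarrow> real) \<Rightarrow> real \<Rightarrow> bool" where
  "feasible_process k hmax x0 xT x u T \<longleftrightarrow>
    T > 0 \<and>
    u \<in> borel_measurable (lebesgue_on {0..T}) \<and>
    (AE t in lebesgue_on {0..T}. \<bar>u t\<bar> \<le> 1) \<and>
    (\<forall>i\<in>{1..k}. absolutely_continuous_on {0..T} (\<lambda>t. x t i)) \<and>
    (\<forall>i\<in>{1..<k}. AE t in lebesgue_on {0..T}.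
       ((\<lambda>s. x s i) has_real_derivative x t (i + 1)) (at t within {0..T})) \<and>
    (AE t in lebesgue_on {0..T}.
       ((\<lambda>s. x s k) has_real_derivative u t) (at t within {0..T})) \<and>
    (\<forall>i\<in>{1..k}. x 0 i = x0 i) \<and>
    (\<forall>i\<in>{1..k}. x T i = xT i) \<and>
    (\<forall>t\<in>{0..T}. x t 1 \<le> hmax)"

definition time_optimal_solution ::
  "nat \<Rightarrow> real \<Rightarrow> (nat \<Rightarrow> real) \<Rightarrow> (nat \<Rightarrow> real) \<Rightarrow>
   (real \<Rightarrow> nat \<Rightarrow> real) \<Rightarrow> (real \<Rightarrow> real) \<Rightarrow> real \<Rightarrow> bool" where
  "time_optimal_solution k hmax x0 xT x u T \<longleftrightarrow>
    feasible_process k hmax x0 xT x u T \<and>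
    (\<forall>x' u' T'. feasible_process k hmax x0 xT x' u' T' \<longrightarrow> T \<le> T')"

definition contact_set :: "real \<Rightarrow> (real \<Rightarrow> nat \<Rightarrow> real) \<Rightarrow> real \<Rightarrow> real set" where
  "contact_set hmax x T = {t \<in> {0..T}. x t 1 = hmax}"

definition stationary_contact_set ::
  "nat \<Rightarrow> real \<Rightarrow> (real \<Rightarrow> nat \<Rightarrow> real) \<Rightarrow> real \<Rightarrow> real set" where
  "stationary_contact_set k hmax x T =
    {t \<in> contact_set hmax x T. \<forall>i\<in>{2..k}. x t i = 0}"

end

theory Submission
  imports Defs
begin

text \<open>At a limit point of the contact set, Rolle's theorem applied repeatedly to the coordinates
  shows that all of \<open>x\<^sub>2, \<dots>, x\<^sub>k\<close> vanish, so limit points of \<open>\<Sigma>\<close> lie in \<open>\<Sigma>\<^sub>0\<close>. On the other hand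
  \<open>\<Sigma>\<^sub>0\<close> has at most one element: at two of its points the state is the same vector, and cutting out
  the piece of trajectory between them would give a faster feasible process. Hence \<open>\<Sigma>\<close> is a compact
  set with at most one limit point.\<close>

section \<open>Exceptional null sets and rules for absolutely continuous functions\<close>

text \<open>Makes the exceptional set explicit, so that it can be translated, united with other null
  sets, and reused on subintervals.\<close>

lemma AE_lebesgue_on_Icc_iff_negligible:
  "(AE t in lebesgue_on {a..b::real}. P t) \<longleftrightarrow> (\<exists>N. negligible N \<and> (\<forall>t\<in>{a..b} - N. P t))"
proof -
  have "(AE t in lebesgue_on {a..b}. P t) \<longleftrightarrow> (\<exists>N. negligible N \<and> {t. \<not> (t \<in> {a..b} \<longrightarrow> P t)} \<subseteq> N)"
    by (subst AE_restrict_space_iff)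
      (auto simp: eventually_ae_filter negligible_iff_null_sets Bex_def)
  also have "\<dots> \<longleftrightarrow> (\<exists>N. negligible N \<and> (\<forall>t\<in>{a..b} - N. P t))"
    by (intro ex_cong) auto
  finally show ?thesis .
qed

lemma absolutely_continuous_onE:
  assumes "absolutely_continuous_on S f" "\<epsilon> > 0"
  obtains \<delta> where "\<delta> > 0" "\<And>(n::nat) a b. \<lbrakk>\<forall>j<n. a j \<le> b j \<and> {a j..b j} \<subseteq> S;
    disjoint_family_on (\<lambda>j. {a j<..<b j}) {..<n}; (\<Sum>j<n. b j - a j) < \<delta>\<rbrakk>
    \<Longrightarrow> (\<Sum>j<n. \<bar>f (b j) - f (a j)\<bar>) < \<epsilon>"
proof -
  from mp[OF spec[OF iffD1[OF absolutely_continuous_on_def assms(1)]] assms(2)]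
  obtain \<delta> where "\<delta> > 0" and \<delta>: "\<forall>(n::nat) a b. (\<forall>j<n. a j \<le> b j \<and> {a j..b j} \<subseteq> S) \<and>
      disjoint_family_on (\<lambda>j. {a j<..<b j}) {..<n} \<and> (\<Sum>j<n. b j - a j) < \<delta>
      \<longrightarrow> (\<Sum>j<n. \<bar>f (b j) - f (a j)\<bar>) < \<epsilon>"
    by (elim exE conjE)
  show thesis
  proof (rule that[OF \<open>\<delta> > 0\<close>])
    fix n :: nat and a b
    assume "\<forall>j<n. a j \<le> b j \<and> {a j..b j} \<subseteq> S" "disjoint_family_on (\<lambda>j. {a j<..<b j}) {..<n}"
      "(\<Sum>j<n. b j - a j) < \<delta>"
    then show "(\<Sum>j<n. \<bar>f (b j) - f (a j)\<bar>) < \<epsilon>"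
      by (intro mp[OF spec[OF spec[OF spec[OF \<delta>]]]] conjI)
  qed
qed

text \<open>An enumeration of \<open>I\<close> reduces this to the families indexed by
  \<open>{..<n}\<close> in the definition. Arbitrary finite index sets are wanted because the
  intervals of a tagged division are indexed by pairs of a tag and a set.\<close>

lemma absolutely_continuous_onD:
  assumes "absolutely_continuous_on S f" "\<epsilon> > 0"
  obtains \<delta> where "\<delta> > 0"
    "\<And>(I::'i set) a b. \<lbrakk>finite I; \<forall>i\<in>I. a i \<le> b i \<and> {a i..b i} \<subseteq> S;
      disjoint_family_on (\<lambda>i. {a i<..<b i}) I; (\<Sum>i\<in>I. b i - a i) < \<delta>\<rbrakk>
      \<Longrightarrow> (\<Sum>i\<in>I. \<bar>f (b i) - f (a i)\<bar>) < \<epsilon>"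
proof -
  obtain \<delta> where "\<delta> > 0" and \<delta>: "\<And>(n::nat) a b. \<lbrakk>\<forall>j<n. a j \<le> b j \<and> {a j..b j} \<subseteq> S;
      disjoint_family_on (\<lambda>j. {a j<..<b j}) {..<n}; (\<Sum>j<n. b j - a j) < \<delta>\<rbrakk>
      \<Longrightarrow> (\<Sum>j<n. \<bar>f (b j) - f (a j)\<bar>) < \<epsilon>"
    using that by (rule absolutely_continuous_onE[OF assms])
  show thesis
  proof (rule that[OF \<open>\<delta> > 0\<close>])
    fix I :: "'i set" and a b
    assume I: "finite I" "\<forall>i\<in>I. a i \<le> b i \<and> {a i..b i} \<subseteq> S"
      "disjoint_family_on (\<lambda>i. {a i<..<b i}) I" "(\<Sum>i\<in>I. b i - a i) < \<delta>"
    obtain h where h: "bij_betw h {..<card I} I"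
      using ex_bij_betw_nat_finite[OF I(1)] by (auto simp: atLeast0LessThan)
    have hI: "h j \<in> I" if "j < card I" for j
      using bij_betwE[OF h] that by auto
    have hinj: "inj_on h {..<card I}"
      using h by (rule bij_betw_imp_inj_on)
    have "(\<Sum>j<card I. \<bar>f (b (h j)) - f (a (h j))\<bar>) < \<epsilon>"
    proof (rule \<delta>)
      show "disjoint_family_on (\<lambda>j. {a (h j)<..<b (h j)}) {..<card I}"
        using I(3) hI hinj unfolding disjoint_family_on_def
        by (metis inj_on_eq_iff lessThan_iff)
      show "(\<Sum>j<card I. b (h j) - a (h j)) < \<delta>"
        using I(4) sum.reindex_bij_betw[OF h, of "\<lambda>i. b i - a i"] by simp
    qed (use I hI in auto)
    then show "(\<Sum>i\<in>I. \<bar>f (b i) - f (a i)\<bar>) < \<epsilon>"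
      using sum.reindex_bij_betw[OF h, of "\<lambda>i. \<bar>f (b i) - f (a i)\<bar>"] by simp
  qed
qed

lemma absolutely_continuous_on_cong:
  assumes "absolutely_continuous_on S f" "\<And>t. t \<in> S \<Longrightarrow> f t = g t"
  shows "absolutely_continuous_on S g"
  unfolding absolutely_continuous_on_def
proof (intro allI impI)
  fix \<epsilon> :: real assume "\<epsilon> > 0"
  obtain \<delta> where \<delta>: "\<delta> > 0" "\<And>(n::nat) a b. \<lbrakk>\<forall>j<n. a j \<le> b j \<and> {a j..b j} \<subseteq> S;
      disjoint_family_on (\<lambda>j. {a j<..<b j}) {..<n}; (\<Sum>j<n. b j - a j) < \<delta>\<rbrakk>
      \<Longrightarrow> (\<Sum>j<n. \<bar>f (b j) - f (a j)\<bar>) < \<epsilon>"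
    using that by (rule absolutely_continuous_onE[OF assms(1) \<open>\<epsilon> > 0\<close>])
  show "\<exists>\<delta>>0. \<forall>(n::nat) a b.
      (\<forall>j<n. a j \<le> b j \<and> {a j..b j} \<subseteq> S) \<and> disjoint_family_on (\<lambda>j. {a j<..<b j}) {..<n} \<and>
      (\<Sum>j<n. b j - a j) < \<delta> \<longrightarrow> (\<Sum>j<n. \<bar>g (b j) - g (a j)\<bar>) < \<epsilon>"
  proof (intro exI[of _ "\<delta>"] conjI allI impI, fact, elim conjE)
    fix n :: nat and a b
    assume ab: "\<forall>j<n. a j \<le> b j \<and> {a j..b j} \<subseteq> S"
      and disj: "disjoint_family_on (\<lambda>j. {a j<..<b j}) {..<n}"
      and len: "(\<Sum>j<n. b j - a j) < \<delta>"
    have "(\<Sum>j<n. \<bar>g (b j) - g (a j)\<bar>) = (\<Sum>j<n. \<bar>f (b j) - f (a j)\<bar>)"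
    proof (intro sum.cong refl)
      fix j assume "j \<in> {..<n}"
      then have "a j \<le> b j" "{a j..b j} \<subseteq> S" using ab by auto
      then have "a j \<in> S" "b j \<in> S" by auto
      then show "\<bar>g (b j) - g (a j)\<bar> = \<bar>f (b j) - f (a j)\<bar>" using assms(2) by simp
    qed
    with \<delta>(2)[OF ab disj len] show "(\<Sum>j<n. \<bar>g (b j) - g (a j)\<bar>) < \<epsilon>" by simp
  qed
qed

lemma absolutely_continuous_on_add:
  assumes "absolutely_continuous_on S f" "absolutely_continuous_on S g"
  shows "absolutely_continuous_on S (\<lambda>t. f t + g t)"
  unfolding absolutely_continuous_on_def
proof (intro allI impI)
  fix \<epsilon> :: real assume "\<epsilon> > 0"
  then have e: "\<epsilon> / 2 > 0" by simp
  obtain d1 where d1: "d1 > 0" "\<And>(n::nat) a b. \<lbrakk>\<forall>j<n. a j \<le> b j \<and> {a j..b j} \<subseteq> S;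
      disjoint_family_on (\<lambda>j. {a j<..<b j}) {..<n}; (\<Sum>j<n. b j - a j) < d1\<rbrakk>
      \<Longrightarrow> (\<Sum>j<n. \<bar>f (b j) - f (a j)\<bar>) < \<epsilon> / 2"
    using that by (rule absolutely_continuous_onE[OF assms(1) e])
  obtain d2 where d2: "d2 > 0" "\<And>(n::nat) a b. \<lbrakk>\<forall>j<n. a j \<le> b j \<and> {a j..b j} \<subseteq> S;
      disjoint_family_on (\<lambda>j. {a j<..<b j}) {..<n}; (\<Sum>j<n. b j - a j) < d2\<rbrakk>
      \<Longrightarrow> (\<Sum>j<n. \<bar>g (b j) - g (a j)\<bar>) < \<epsilon> / 2"
    using that by (rule absolutely_continuous_onE[OF assms(2) e])
  have "min d1 d2 > 0" using d1(1) d2(1) by simp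
  show "\<exists>\<delta>>0. \<forall>(n::nat) a b.
      (\<forall>j<n. a j \<le> b j \<and> {a j..b j} \<subseteq> S) \<and> disjoint_family_on (\<lambda>j. {a j<..<b j}) {..<n} \<and>
      (\<Sum>j<n. b j - a j) < \<delta> \<longrightarrow> (\<Sum>j<n. \<bar>f (b j) + g (b j) - (f (a j) + g (a j))\<bar>) < \<epsilon>"
  proof (intro exI[of _ "min d1 d2"] conjI allI impI, fact, elim conjE)
    fix n :: nat and a b
    assume ab: "\<forall>j<n. a j \<le> b j \<and> {a j..b j} \<subseteq> S"
      and disj: "disjoint_family_on (\<lambda>j. {a j<..<b j}) {..<n}"
      and len: "(\<Sum>j<n. b j - a j) < min d1 d2"
    have "(\<Sum>j<n. \<bar>f (b j) + g (b j) - (f (a j) + g (a j))\<bar>)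
        \<le> (\<Sum>j<n. \<bar>f (b j) - f (a j)\<bar> + \<bar>g (b j) - g (a j)\<bar>)"
      by (intro sum_mono) linarith
    also have "\<dots> = (\<Sum>j<n. \<bar>f (b j) - f (a j)\<bar>) + (\<Sum>j<n. \<bar>g (b j) - g (a j)\<bar>)"
      by (rule sum.distrib)
    also have "\<dots> < \<epsilon> / 2 + \<epsilon> / 2"
      using len by (intro add_strict_mono d1(2)[OF ab disj] d2(2)[OF ab disj]) auto
    finally show "(\<Sum>j<n. \<bar>f (b j) + g (b j) - (f (a j) + g (a j))\<bar>) < \<epsilon>" by simp
  qed
qed

lemma absolutely_continuous_on_affine: "absolutely_continuous_on S (\<lambda>t. c * t + d)"
  unfolding absolutely_continuous_on_def
proof (intro allI impI)
  fix \<epsilon> :: real assume "\<epsilon> > 0"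
  \<comment> \<open>The summand 1 keeps the divisor positive when \<open>c\<close> is 0.\<close>
  define \<delta> where "\<delta> = \<epsilon> / (\<bar>c\<bar> + 1)"
  have "\<delta> > 0" using \<open>\<epsilon> > 0\<close> by (simp add: \<delta>_def add_nonneg_pos)
  show "\<exists>\<delta>>0. \<forall>(n::nat) a b.
      (\<forall>j<n. a j \<le> b j \<and> {a j..b j} \<subseteq> S) \<and> disjoint_family_on (\<lambda>j. {a j<..<b j}) {..<n} \<and>
      (\<Sum>j<n. b j - a j) < \<delta> \<longrightarrow> (\<Sum>j<n. \<bar>c * b j + d - (c * a j + d)\<bar>) < \<epsilon>"
  proof (intro exI[of _ "\<delta>"] conjI allI impI, fact, elim conjE)
    fix n :: nat and a b
    assume ab: "\<forall>j<n. a j \<le> b j \<and> {a j..b j} \<subseteq> S"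
      and disj: "disjoint_family_on (\<lambda>j. {a j<..<b j}) {..<n}"
      and len: "(\<Sum>j<n. b j - a j) < \<delta>"
    have "(\<Sum>j<n. \<bar>c * b j + d - (c * a j + d)\<bar>) = (\<Sum>j<n. \<bar>c\<bar> * (b j - a j))"
    proof (intro sum.cong refl)
      fix j assume "j \<in> {..<n}"
      then have "a j \<le> b j" using ab by simp
      moreover have "c * b j + d - (c * a j + d) = c * (b j - a j)"
        by (simp add: right_diff_distrib)
      ultimately show "\<bar>c * b j + d - (c * a j + d)\<bar> = \<bar>c\<bar> * (b j - a j)"
        by (simp add: abs_mult)
    qed
    also have "\<dots> \<le> (\<bar>c\<bar> + 1) * (\<Sum>j<n. b j - a j)"
      unfolding sum_distrib_left using ab by (intro sum_mono mult_right_mono) auto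
    also have "\<dots> < \<epsilon>"
      using len by (simp add: \<delta>_def pos_less_divide_eq mult.commute)
    finally show "(\<Sum>j<n. \<bar>c * b j + d - (c * a j + d)\<bar>) < \<epsilon>" .
  qed
qed

text \<open>A monotone \<open>h\<close> that grows no faster than the identity sends intervals with
  disjoint interiors to intervals with disjoint interiors and does not increase their total length,
  so the \<open>\<delta>\<close> of \<open>f\<close> still serves. The intended \<open>h\<close> are
  truncations and shifts of time.\<close>

lemma absolutely_continuous_on_compose:
  assumes f: "absolutely_continuous_on S f" and h: "mono h"
    and lip: "\<And>s t. s \<le> t \<Longrightarrow> h t - h s \<le> t - s"
    and maps: "\<And>s t. {s..t} \<subseteq> S' \<Longrightarrow> s \<le> t \<Longrightarrow> {h s..h t} \<subseteq> S"
  shows "absolutely_continuous_on S' (\<lambda>t. f (h t))"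
  unfolding absolutely_continuous_on_def
proof (intro allI impI)
  fix \<epsilon> :: real assume "\<epsilon> > 0"
  obtain \<delta> where \<delta>: "\<delta> > 0" "\<And>(n::nat) a b. \<lbrakk>\<forall>j<n. a j \<le> b j \<and> {a j..b j} \<subseteq> S;
      disjoint_family_on (\<lambda>j. {a j<..<b j}) {..<n}; (\<Sum>j<n. b j - a j) < \<delta>\<rbrakk>
      \<Longrightarrow> (\<Sum>j<n. \<bar>f (b j) - f (a j)\<bar>) < \<epsilon>"
    using that by (rule absolutely_continuous_onE[OF f \<open>\<epsilon> > 0\<close>])
  have hless: "s < t" if "h s < h t" for s t
    using monoD[OF h, of t s] that by linarith
  show "\<exists>\<delta>>0. \<forall>(n::nat) a b.
      (\<forall>j<n. a j \<le> b j \<and> {a j..b j} \<subseteq> S') \<and> disjoint_family_on (\<lambda>j. {a j<..<b j}) {..<n} \<and>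
      (\<Sum>j<n. b j - a j) < \<delta> \<longrightarrow> (\<Sum>j<n. \<bar>f (h (b j)) - f (h (a j))\<bar>) < \<epsilon>"
  proof (intro exI[of _ "\<delta>"] conjI allI impI, fact, elim conjE)
    fix n :: nat and a b
    assume ab: "\<forall>j<n. a j \<le> b j \<and> {a j..b j} \<subseteq> S'"
      and disj: "disjoint_family_on (\<lambda>j. {a j<..<b j}) {..<n}"
      and len: "(\<Sum>j<n. b j - a j) < \<delta>"
    show "(\<Sum>j<n. \<bar>f (h (b j)) - f (h (a j))\<bar>) < \<epsilon>"
    proof (rule \<delta>(2))
      show "\<forall>j<n. h (a j) \<le> h (b j) \<and> {h (a j)..h (b j)} \<subseteq> S"
      proof (intro allI impI conjI)
        fix j assume "j < n"
        with ab have j: "a j \<le> b j" "{a j..b j} \<subseteq> S'" by auto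
        from monoD[OF h j(1)] show "h (a j) \<le> h (b j)" .
        from maps[OF j(2,1)] show "{h (a j)..h (b j)} \<subseteq> S" .
      qed
      show "disjoint_family_on (\<lambda>j. {h (a j)<..<h (b j)}) {..<n}"
        unfolding disjoint_family_on_def
      proof (intro ballI impI equals0I)
        fix i j p assume ij: "i \<in> {..<n}" "j \<in> {..<n}" "i \<noteq> j"
          and p: "p \<in> {h (a i)<..<h (b i)} \<inter> {h (a j)<..<h (b j)}"
        \<comment> \<open>A common point \<open>p\<close> puts each image of a left end point
          strictly below each image of a right end point, and \<open>hless\<close> pulls these
          inequalities back to the end points themselves.\<close>
        have "max (a i) (a j) < min (b i) (b j)"
          using p hless[of "a i" "b i"] hless[of "a i" "b j"] hless[of "a j" "b i"] hless[of "a j" "b j"]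
          by auto
        then obtain q where "max (a i) (a j) < q" "q < min (b i) (b j)"
          using dense by blast
        then have "q \<in> {a i<..<b i} \<inter> {a j<..<b j}" by auto
        with disj ij show False unfolding disjoint_family_on_def by blast
      qed
      have "(\<Sum>j<n. h (b j) - h (a j)) \<le> (\<Sum>j<n. b j - a j)"
        using ab lip by (intro sum_mono) auto
      with len show "(\<Sum>j<n. h (b j) - h (a j)) < \<delta>" by simp
    qed
  qed
qed

lemma absolutely_continuous_on_subset:
  "absolutely_continuous_on S f \<Longrightarrow> S' \<subseteq> S \<Longrightarrow> absolutely_continuous_on S' f"
  by (erule absolutely_continuous_on_compose[where h = "\<lambda>t. t"]) (auto simp: mono_def)

section \<open>From derivatives almost everywhere to increments and derivatives everywhere\<close>

lemma absolutely_continuous_on_imp_continuous_on: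
  assumes "absolutely_continuous_on {a..b} f"
  shows "continuous_on {a..b} f"
  unfolding continuous_on_iff
proof (intro ballI allI impI)
  fix t \<epsilon> :: real assume t: "t \<in> {a..b}" and "\<epsilon> > 0"
  obtain \<delta> where \<delta>: "\<delta> > 0" "\<And>(n::nat) a' b'. \<lbrakk>\<forall>j<n. a' j \<le> b' j \<and> {a' j..b' j} \<subseteq> {a..b};
      disjoint_family_on (\<lambda>j. {a' j<..<b' j}) {..<n}; (\<Sum>j<n. b' j - a' j) < \<delta>\<rbrakk>
      \<Longrightarrow> (\<Sum>j<n. \<bar>f (b' j) - f (a' j)\<bar>) < \<epsilon>"
    using that by (rule absolutely_continuous_onE[OF assms \<open>\<epsilon> > 0\<close>])
  have "dist (f s) (f t) < \<epsilon>" if "s \<in> {a..b}" "dist s t < \<delta>" for s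
    using \<delta>(2)[of 1 "\<lambda>_. min s t" "\<lambda>_. max s t"] t that
    by (cases "s \<le> t")
      (auto simp: disjoint_family_on_def dist_real_def min_def max_def abs_minus_commute)
  with \<delta>(1) show "\<exists>d>0. \<forall>s\<in>{a..b}. dist s t < d \<longrightarrow> dist (f s) (f t) < \<epsilon>"
    by blast
qed

text \<open>A division fine for the following gauge is used: at a point off the null set it is given by the
  derivative bound, at a point of the null set by an open superset of small measure, whose
  contribution absolute continuity makes negligible.\<close>
lemma absolutely_continuous_derivative_bound:
  assumes "a \<le> b" and ac: "absolutely_continuous_on {a..b} f" and N: "negligible N"
    and df: "\<And>t. t \<in> {a..b} - N \<Longrightarrow> \<exists>D. (f has_real_derivative D) (at t within {a..b}) \<and> \<bar>D\<bar> \<le> M"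
  shows "\<bar>f b - f a\<bar> \<le> M * (b - a)"
proof -
  \<comment> \<open>The separate \<open>\<epsilon>\<close> pays for the intervals tagged in
    \<open>N\<close>; the one added to \<open>M\<close> pays for the error of the linear
    approximation at the other tags.\<close>
  have main: "\<bar>f b - f a\<bar> \<le> \<epsilon> + (M + \<epsilon>) * (b - a)" if "\<epsilon> > 0" "M + \<epsilon> \<ge> 0" for \<epsilon>
  proof -
    obtain \<delta> where "\<delta> > 0" and \<delta>: "\<And>(I::(real \<times> real set) set) a' b'. \<lbrakk>finite I;
      \<forall>i\<in>I. a' i \<le> b' i \<and> {a' i..b' i} \<subseteq> {a..b};
      disjoint_family_on (\<lambda>i. {a' i<..<b' i}) I; (\<Sum>i\<in>I. b' i - a' i) < \<delta>\<rbrakk>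
      \<Longrightarrow> (\<Sum>i\<in>I. \<bar>f (b' i) - f (a' i)\<bar>) < \<epsilon>"
      using that by (rule absolutely_continuous_onD[OF ac \<open>\<epsilon> > 0\<close>])
    obtain U where U: "open U" "N \<subseteq> U" "U \<in> lmeasurable" "measure lebesgue U < \<delta>"
    proof -
      obtain U where U: "open U" "N \<subseteq> U" "U - N \<in> lmeasurable" "emeasure lebesgue (U - N) < ennreal \<delta>"
        using sets_lebesgue_outer_open[OF negligible_imp_sets[OF N] \<open>\<delta> > 0\<close>] by blast
      have nN: "N \<in> null_sets lebesgue" using N by (simp add: negligible_iff_null_sets)
      have Us: "U \<in> sets lebesgue" using U(1) by simp
      have eq: "emeasure lebesgue U = emeasure lebesgue (U - N)"
        using emeasure_Diff_null_set[OF nN Us] by simp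
      have "emeasure lebesgue U < ennreal \<delta>" using U(4) eq by simp
      moreover from this have Um: "U \<in> lmeasurable"
        using Us by (intro fmeasurableI) (auto intro: order.strict_trans)
      ultimately have "measure lebesgue U < \<delta>"
        using \<open>\<delta> > 0\<close> by (simp add: emeasure_eq_measure2 ennreal_less_iff)
      with U Um that show thesis by blast
    qed
    have "\<exists>d>0. (t \<in> N \<longrightarrow> ball t d \<subseteq> U) \<and>
        (t \<notin> N \<longrightarrow> (\<forall>s\<in>{a..b}. \<bar>s - t\<bar> < d \<longrightarrow> \<bar>f s - f t\<bar> \<le> (M + \<epsilon>) * \<bar>s - t\<bar>))"
      if "t \<in> {a..b}" for t
    proof (cases "t \<in> N")
      case True
      then show ?thesis using U openE by blast
    next
      case False
      with df that obtain D where D: "(f has_real_derivative D) (at t within {a..b})" "\<bar>D\<bar> \<le> M"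
        by blast
      obtain d where "d > 0" and d: "\<And>s. s \<in> {a..b} \<Longrightarrow> \<bar>s - t\<bar> < d \<Longrightarrow>
          \<bar>f s - f t - D * (s - t)\<bar> \<le> \<epsilon> * \<bar>s - t\<bar>"
        using D(1) \<open>\<epsilon> > 0\<close> unfolding has_field_derivative_def has_derivative_within_alt
        by (auto simp: real_norm_def)
      have "\<bar>f s - f t\<bar> \<le> (M + \<epsilon>) * \<bar>s - t\<bar>" if "s \<in> {a..b}" "\<bar>s - t\<bar> < d" for s
      proof -
        have "\<bar>D * (s - t)\<bar> \<le> M * \<bar>s - t\<bar>"
          unfolding abs_mult using D(2) by (intro mult_right_mono) auto
        with d[OF that] show ?thesis by (simp add: distrib_right)
      qed
      with \<open>d > 0\<close> False show ?thesis by blast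
    qed
    then obtain d where d: "\<And>t. t \<in> {a..b} \<Longrightarrow> d t > 0"
      "\<And>t. t \<in> {a..b} \<Longrightarrow> t \<in> N \<Longrightarrow> ball t (d t) \<subseteq> U"
      "\<And>t s. t \<in> {a..b} \<Longrightarrow> t \<notin> N \<Longrightarrow> s \<in> {a..b} \<Longrightarrow> \<bar>s - t\<bar> < d t \<Longrightarrow> \<bar>f s - f t\<bar> \<le> (M + \<epsilon>) * \<bar>s - t\<bar>"
      by metis
    \<comment> \<open>The radius 1 outside \<open>{a..b}\<close> is a default that makes
      \<open>\<gamma>\<close> a gauge on the whole line; all tags lie in
      \<open>{a..b}\<close>.\<close>
    define \<gamma> where "\<gamma> t = ball t (if t \<in> {a..b} then d t else 1)" for t
    have "gauge \<gamma>" unfolding gauge_def \<gamma>_def using d(1) by auto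
    then obtain p where p: "p tagged_division_of {a..b}" "\<gamma> fine p"
      using fine_division_exists_real by blast
    note pD = tagged_division_ofD[OF p(1)]
    have K: "Inf K \<le> Sup K \<and> K = {Inf K..Sup K} \<and> t \<in> {Inf K..Sup K} \<and> t \<in> {a..b} \<and>
        {Inf K..Sup K} \<subseteq> {a..b} \<and> {Inf K..Sup K} \<subseteq> ball t (d t)" if tK: "(t, K) \<in> p" for t K
    proof -
      obtain l r where lr: "K = {l..r}" using pD(4)[OF tK] by auto
      moreover have "t \<in> K" "K \<subseteq> {a..b}" using pD(2,3)[OF tK] by auto
      moreover have "K \<subseteq> \<gamma> t" using fineD[OF p(2) tK] .
      ultimately show ?thesis unfolding \<gamma>_def by (auto split: if_splits)
    qed
    define F where "F = (\<lambda>(t::real, K::real set). \<bar>f (Sup K) - f (Inf K)\<bar>)"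
    define B where "B = {(t, K) \<in> p. t \<in> N}"
    have finB: "finite B" and Bp: "B \<subseteq> p"
      unfolding B_def using pD(1) by (auto intro: rev_finite_subset)
    have lenp: "(\<Sum>(t, K)\<in>p. Sup K - Inf K) = b - a"
      using additive_tagged_division_1[OF \<open>a \<le> b\<close> p(1), of "\<lambda>t. t"] .
    have bad: "sum F B < \<epsilon>"
    proof -
      let ?J = "\<lambda>i::real \<times> real set. {Inf (snd i)<..<Sup (snd i)}"
      have disj: "disjoint_family_on ?J B"
        unfolding disjoint_family_on_def
      proof (intro ballI impI)
        fix i j assume "i \<in> B" "j \<in> B" "i \<noteq> j"
        then obtain t K t' K' where ij: "i = (t, K)" "j = (t', K')" "(t, K) \<in> p" "(t', K') \<in> p"
            "(t, K) \<noteq> (t', K')"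
          using Bp by (metis subsetD surj_pair)
        have "interior K = {Inf K<..<Sup K}" "interior K' = {Inf K'<..<Sup K'}"
          using K[OF ij(3)] K[OF ij(4)] interior_atLeastAtMost_real by metis+
        with pD(5)[OF ij(3,4,5)] ij show "?J i \<inter> ?J j = {}" by simp
      qed
      \<comment> \<open>The total length is rewritten as the measure of one disjoint union, because
        fineness places that union inside \<open>U\<close>, whose measure is below
        \<open>\<delta>\<close>.\<close>
      have "(\<Sum>i\<in>B. Sup (snd i) - Inf (snd i)) = (\<Sum>i\<in>B. measure lebesgue (?J i))"
        using K Bp by (intro sum.cong refl) (auto simp: case_prod_unfold)
      also have "\<dots> = measure lebesgue (\<Union>i\<in>B. ?J i)"
        using disj finB by (intro measure_UNION'[symmetric])
          (auto simp: disjoint_family_on_def pairwise_def disjnt_def)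
      also have "\<dots> \<le> measure lebesgue U"
      proof (rule measure_mono_fmeasurable)
        show "(\<Union>i\<in>B. ?J i) \<subseteq> U"
        proof (rule UN_least)
          fix i assume "i \<in> B"
          then obtain t K where "i = (t, K)" "(t, K) \<in> p" "t \<in> N" by (auto simp: B_def)
          then show "?J i \<subseteq> U" using K[of t K] d(2)[of t] by fastforce
        qed
      qed (use finB U in auto)
      finally have "(\<Sum>i\<in>B. Sup (snd i) - Inf (snd i)) < \<delta>" using U(4) by simp
      moreover have "\<forall>i\<in>B. Inf (snd i) \<le> Sup (snd i) \<and> {Inf (snd i)..Sup (snd i)} \<subseteq> {a..b}"
      proof
        fix i assume "i \<in> B"
        then have "(fst i, snd i) \<in> p" using Bp by auto
        from K[OF this] show "Inf (snd i) \<le> Sup (snd i) \<and> {Inf (snd i)..Sup (snd i)} \<subseteq> {a..b}" by blast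
      qed
      ultimately have "(\<Sum>i\<in>B. \<bar>f (Sup (snd i)) - f (Inf (snd i))\<bar>) < \<epsilon>"
        using finB disj by (intro \<delta>)
      then show ?thesis unfolding F_def by (simp add: case_prod_unfold)
    qed
    have good: "sum F (p - B) \<le> (M + \<epsilon>) * (b - a)"
    proof -
      have "sum F (p - B) \<le> (\<Sum>(t, K)\<in>p - B. (M + \<epsilon>) * (Sup K - Inf K))"
      proof (rule sum_mono)
        fix i assume "i \<in> p - B"
        then obtain t K where i: "i = (t, K)" "(t, K) \<in> p" "t \<notin> N" by (auto simp: B_def)
        have t: "t \<in> {a..b}" "Inf K \<in> {a..b}" "Sup K \<in> {a..b}" "Inf K \<le> t" "t \<le> Sup K"
          "\<bar>Inf K - t\<bar> < d t" "\<bar>Sup K - t\<bar> < d t"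
          using K[OF i(2)] by (auto simp: subset_iff dist_real_def abs_minus_commute)
        \<comment> \<open>Both end points are compared with the tag; as the tag lies between them,
          the two distances add up to the length of \<open>K\<close>.\<close>
        have "\<bar>f (Sup K) - f (Inf K)\<bar> \<le> (M + \<epsilon>) * \<bar>Sup K - t\<bar> + (M + \<epsilon>) * \<bar>Inf K - t\<bar>"
          using d(3)[OF t(1) i(3) t(2,6)] d(3)[OF t(1) i(3) t(3,7)] by linarith
        also have "\<dots> = (M + \<epsilon>) * (Sup K - Inf K)"
          using t by (simp add: algebra_simps)
        finally show "F i \<le> (case i of (t, K) \<Rightarrow> (M + \<epsilon>) * (Sup K - Inf K))"
          by (simp add: F_def i)
      qed
      \<comment> \<open>The terms over \<open>B\<close> may be added back since
        \<open>M + \<epsilon>\<close> is nonnegative.\<close>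
      also have "\<dots> \<le> (\<Sum>(t, K)\<in>p. (M + \<epsilon>) * (Sup K - Inf K))"
        using K that by (intro sum_mono2 pD(1)) (auto simp: case_prod_unfold)
      also have "\<dots> = (M + \<epsilon>) * (b - a)"
        unfolding lenp[symmetric] by (simp add: sum_distrib_left case_prod_unfold)
      finally show ?thesis .
    qed
    have "\<bar>f b - f a\<bar> = \<bar>\<Sum>(t, K)\<in>p. f (Sup K) - f (Inf K)\<bar>"
      by (simp add: additive_tagged_division_1[OF \<open>a \<le> b\<close> p(1)])
    also have "\<dots> \<le> sum F p"
      unfolding F_def by (rule order_trans[OF sum_abs]) (simp add: case_prod_unfold)
    also have "\<dots> = sum F B + sum F (p - B)"
      using sum.subset_diff[OF Bp pD(1), of F] by simp
    finally show ?thesis using bad good by linarith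
  qed
  show ?thesis
  proof (cases "a = b")
    case False
    \<comment> \<open>A nondegenerate interval has a point outside \<open>N\<close>, and the
      derivative bound at that point gives the sign of \<open>M\<close>.\<close>
    have "\<not> {a..b} \<subseteq> N"
    proof
      assume "{a..b} \<subseteq> N"
      then have "negligible {a..b}" using N negligible_subset by blast
      with False \<open>a \<le> b\<close> show False
        by (metis box_real greaterThanLessThan_empty_iff negligible_interval(1) order_antisym)
    qed
    with df have "M \<ge> 0" by (metis DiffI abs_ge_zero order_trans subsetI)
    have "\<bar>f b - f a\<bar> \<le> M * (b - a) + e" if "e > 0" for e
    proof -
      \<comment> \<open>Chosen so that the two error terms of \<open>main\<close>,
        \<open>\<epsilon>\<close> and \<open>\<epsilon> * (b - a)\<close>, add up to exactly
        \<open>e\<close>.\<close>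
      define \<epsilon> where "\<epsilon> = e / (1 + (b - a))"
      have "\<epsilon> > 0" using that \<open>a \<le> b\<close> by (simp add: \<epsilon>_def)
      then have "\<bar>f b - f a\<bar> \<le> \<epsilon> + (M + \<epsilon>) * (b - a)" using \<open>M \<ge> 0\<close> by (intro main) auto
      also have "\<dots> = M * (b - a) + \<epsilon> * (1 + (b - a))" by (simp add: algebra_simps)
      also have "\<epsilon> * (1 + (b - a)) = e" using \<open>a \<le> b\<close> by (simp add: \<epsilon>_def)
      finally show ?thesis .
    qed
    then show ?thesis by (rule field_le_epsilon)
  qed simp
qed

text \<open>After the linear function with slope \<open>g t\<close> is subtracted from
  \<open>f\<close>, the derivative at almost every \<open>v\<close> is \<open>g v - g t\<close>,
  which is small near \<open>t\<close> by continuity of \<open>g\<close>. The bound on increments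
  then estimates the remainder of the linear approximation at \<open>t\<close>, even if
  \<open>t\<close> lies in \<open>N\<close>.\<close>

lemma absolutely_continuous_has_derivative:
  assumes ac: "absolutely_continuous_on {a..b} f" and N: "negligible N"
    and df: "\<And>t. t \<in> {a..b} - N \<Longrightarrow> (f has_real_derivative g t) (at t within {a..b})"
    and g: "continuous_on {a..b} g" and t: "t \<in> {a<..<b}"
  shows "(f has_real_derivative g t) (at t)"
proof -
  have tab: "t \<in> {a..b}" using t by auto
  have "\<exists>d>0. \<forall>s\<in>{a..b}. \<bar>s - t\<bar> < d \<longrightarrow> \<bar>f s - f t - g t * (s - t)\<bar> \<le> \<epsilon> * \<bar>s - t\<bar>"
    if "\<epsilon> > 0" for \<epsilon>
  proof -
    obtain d where "d > 0" and d: "\<And>s. s \<in> {a..b} \<Longrightarrow> \<bar>s - t\<bar> < d \<Longrightarrow> \<bar>g s - g t\<bar> < \<epsilon>"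
      using g tab \<open>\<epsilon> > 0\<close> unfolding continuous_on_iff dist_real_def by metis
    have "\<bar>f s - f t - g t * (s - t)\<bar> \<le> \<epsilon> * \<bar>s - t\<bar>" if s: "s \<in> {a..b}" "\<bar>s - t\<bar> < d" for s
    proof -
      define l r where "l = min s t" and "r = max s t"
      \<comment> \<open>The summand 0 matches the form of
        \<open>absolutely_continuous_on_affine\<close>.\<close>
      let ?h = "\<lambda>v. f v + (- g t * v + 0)"
      have sub: "{l..r} \<subseteq> {a..b}" using s tab by (auto simp: l_def r_def)
      have "\<bar>?h r - ?h l\<bar> \<le> \<epsilon> * (r - l)"
      proof (rule absolutely_continuous_derivative_bound[OF _ _ N])
        show "absolutely_continuous_on {l..r} ?h"
          by (intro absolutely_continuous_on_add absolutely_continuous_on_affine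
              absolutely_continuous_on_subset[OF ac sub])
        fix v assume v: "v \<in> {l..r} - N"
        have "(f has_real_derivative g v) (at v within {l..r})"
          using df[of v] v sub by (blast intro: DERIV_subset)
        then have "(?h has_real_derivative g v - g t) (at v within {l..r})"
          by (auto intro!: derivative_eq_intros)
        moreover have "\<bar>g v - g t\<bar> \<le> \<epsilon>"
          using d[of v] v sub s by (force simp: l_def r_def)
        ultimately show "\<exists>D. (?h has_real_derivative D) (at v within {l..r}) \<and> \<bar>D\<bar> \<le> \<epsilon>" by blast
      qed (simp add: l_def r_def)
      then show ?thesis
        by (cases "s \<le> t") (simp_all add: l_def r_def min_def max_def algebra_simps abs_minus_commute)
    qed
    with \<open>d > 0\<close> show ?thesis by blast
  qed
  then have "(f has_real_derivative g t) (at t within {a..b})"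
    unfolding has_field_derivative_def has_derivative_within_alt
    by (auto simp: real_norm_def bounded_linear_mult_right)
  with t show ?thesis by (simp add: at_within_Icc_at)
qed

section \<open>Cutting a time interval out of a process\<close>

lemma borel_measurable_lebesgue_on_glue:
  fixes u :: "real \<Rightarrow> real"
  assumes u: "u \<in> borel_measurable (lebesgue_on {0..T})" and "0 \<le> c" "0 \<le> d" "c + d \<le> T"
  shows "(\<lambda>t. if t \<le> c then u t else u (t + d)) \<in> borel_measurable (lebesgue_on {0..T - d})"
proof -
  \<comment> \<open>Extension by zero allows the shift to be treated as a measurable map of the
    whole line; on \<open>{0..T - d}\<close> both branches only evaluate \<open>u\<close> inside
    \<open>{0..T}\<close>.\<close>
  define v where "v t = (if t \<in> {0..T} then u t else 0)" for t
  have v: "v \<in> borel_measurable lebesgue"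
    unfolding v_def[abs_def] using u by (subst borel_measurable_if) auto
  have shift: "(\<lambda>t::real. t + d) \<in> lebesgue \<rightarrow>\<^sub>M lebesgue"
    using lebesgue_affine_measurable[where c = "\<lambda>_::real. 1" and t = d] by (simp add: add.commute)
  have "(\<lambda>t. if t \<le> c then v t else v (t + d)) \<in> borel_measurable lebesgue"
  proof (rule measurable_If)
    show "(\<lambda>t. v (t + d)) \<in> borel_measurable lebesgue"
      using measurable_compose[OF shift v] .
    show "{t \<in> space lebesgue. t \<le> c} \<in> sets lebesgue"
      by (simp flip: atMost_def)
  qed (rule v)
  then have "(\<lambda>t. if t \<le> c then v t else v (t + d)) \<in> borel_measurable (lebesgue_on {0..T - d})"
    by (rule measurable_restrict_space1)
  moreover have "(if t \<le> c then v t else v (t + d)) = (if t \<le> c then u t else u (t + d))"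
    if "t \<in> {0..T - d}" for t
    using that assms by (auto simp: v_def)
  ultimately show ?thesis
    by (subst measurable_cong[symmetric]) auto
qed

text \<open>The glued function is \<open>f (min t c) + f (max t c + d) - f c\<close>, a sum of
  reparametrisations by monotone maps that grow no faster than the identity. The matching condition
  \<open>eq\<close> cancels the last two terms when \<open>t \<le> c\<close>.\<close>

lemma absolutely_continuous_on_glue:
  assumes ac: "absolutely_continuous_on {0..T} f" and "0 \<le> c" "0 \<le> d" "c + d \<le> T" and eq: "f c = f (c + d)"
  shows "absolutely_continuous_on {0..T - d} (\<lambda>t. if t \<le> c then f t else f (t + d))"
proof (rule absolutely_continuous_on_cong)
  \<comment> \<open>The term \<open>0 * t + - f c\<close> is a constant written as an affine
    function.\<close>
  show "absolutely_continuous_on {0..T - d} (\<lambda>t. f (min t c) + (f (max t c + d) + (0 * t + - f c)))"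
    by (intro absolutely_continuous_on_add absolutely_continuous_on_affine
        absolutely_continuous_on_compose[OF ac, where h = "\<lambda>t. min t c"]
        absolutely_continuous_on_compose[OF ac, where h = "\<lambda>t. max t c + d"])
      (use assms(2-4) in \<open>auto simp: mono_def\<close>)
  show "f (min t c) + (f (max t c + d) + (0 * t + - f c)) = (if t \<le> c then f t else f (t + d))" for t
    using eq by (auto simp: min_def max_def)
qed

lemma DERIV_glue:
  assumes "t \<noteq> c" and "t < c \<Longrightarrow> (f has_real_derivative D) (at t)"
    and "t > c \<Longrightarrow> (f has_real_derivative D) (at (t + d))"
  shows "((\<lambda>s. if s \<le> c then f s else f (s + d)) has_real_derivative D) (at t)"
proof (cases "t < c")
  case True
  show ?thesis
    by (rule has_field_derivative_transform_within_open[OF assms(2)[OF True], of "{..<c}"])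
      (use True in auto)
next
  case False
  then have "t > c" using assms(1) by simp
  then have "((\<lambda>s. f (s + d)) has_real_derivative D) (at t)"
    using assms(3) by (simp flip: DERIV_shift)
  then show ?thesis
    by (rule has_field_derivative_transform_within_open[of _ _ _ "{c<..}"])
      (use \<open>t > c\<close> in auto)
qed

lemma AE_glue:
  fixes T c d :: real
  assumes "AE t in lebesgue_on {0..T}. P t" "0 \<le> c" "0 \<le> d" "c + d \<le> T"
    and step: "\<And>t. \<lbrakk>0 < t; t < T - d; t \<noteq> c; t < c \<Longrightarrow> P t; c < t \<Longrightarrow> P (t + d)\<rbrakk> \<Longrightarrow> Q t"
  shows "AE t in lebesgue_on {0..T - d}. Q t"
proof -
  obtain N where N: "negligible N" "\<And>t. t \<in> {0..T} - N \<Longrightarrow> P t"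
    using iffD1[OF AE_lebesgue_on_Icc_iff_negligible assms(1)] by auto
  \<comment> \<open>The translate of \<open>N\<close> covers the times whose shift by
    \<open>d\<close> is exceptional. The junction \<open>c\<close> is dropped because the derivative
    may jump there, the two end points so that \<open>step\<close> deals with interior times only,
    where derivatives are two-sided.\<close>
  let ?N = "N \<union> (+) (- d) ` N \<union> {0, c, T - d}"
  have "negligible ?N"
    using N(1) by (intro negligible_Un negligible_translation) auto
  moreover have "Q t" if t: "t \<in> {0..T - d} - ?N" for t
  proof (rule step)
    have "t + d \<notin> N"
    proof
      assume "t + d \<in> N"
      then have "- d + (t + d) \<in> (+) (- d) ` N" by (rule imageI)
      with t show False by simp
    qed
    then show "P (t + d)" using t N(2)[of "t + d"] assms by auto
    show "P t" using t N(2)[of t] assms by auto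
  qed (use t in auto)
  ultimately show ?thesis unfolding AE_lebesgue_on_Icc_iff_negligible by blast
qed

text \<open>The equations do not depend on time, so a shifted piece of trajectory still solves them,
  and equality of the states at \<open>c\<close> and \<open>c + d\<close> makes the join absolutely
  continuous. The strict inequality \<open>c + d < T\<close> keeps the new duration positive and
  places the new final time after the junction, where the state is that of \<open>x\<close> at
  \<open>T\<close>.\<close>

lemma feasible_process_excise:
  assumes feas: "feasible_process k hmax x0 xT x u T" and c: "0 \<le> c" and d: "0 \<le> d" and cd: "c + d < T"
    and eq: "\<forall>i\<in>{1..k}. x c i = x (c + d) i"
  shows "feasible_process k hmax x0 xT (\<lambda>t. if t \<le> c then x t else x (t + d))
    (\<lambda>t. if t \<le> c then u t else u (t + d)) (T - d)"
proof -
  have cdle: "c + d \<le> T" using cd by simp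
  \<comment> \<open>The right-hand side \<open>g\<close> is left arbitrary: it becomes the next
    coordinate for \<open>i < k\<close> and the control \<open>u\<close> for
    \<open>i = k\<close>.\<close>
  have deriv: "AE t in lebesgue_on {0..T - d}.
      ((\<lambda>s. (if s \<le> c then x s else x (s + d)) i) has_real_derivative
        (if t \<le> c then g t else g (t + d))) (at t within {0..T - d})"
    if "AE t in lebesgue_on {0..T}. ((\<lambda>s. x s i) has_real_derivative g t) (at t within {0..T})" for i g
  proof (rule AE_glue[OF that c d cdle])
    fix t assume t: "0 < t" "t < T - d" "t \<noteq> c"
      and left: "t < c \<Longrightarrow> ((\<lambda>s. x s i) has_real_derivative g t) (at t within {0..T})"
      and right: "c < t \<Longrightarrow> ((\<lambda>s. x s i) has_real_derivative g (t + d)) (at (t + d) within {0..T})"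
    have "((\<lambda>s. if s \<le> c then x s i else x (s + d) i) has_real_derivative
        (if t \<le> c then g t else g (t + d))) (at t)"
      using t left right c d by (intro DERIV_glue) (auto simp: at_within_Icc_at)
    then show "((\<lambda>s. (if s \<le> c then x s else x (s + d)) i) has_real_derivative
        (if t \<le> c then g t else g (t + d))) (at t within {0..T - d})"
      by (simp add: if_distribR has_field_derivative_at_within)
  qed
  have bound: "AE t in lebesgue_on {0..T - d}. \<bar>if t \<le> c then u t else u (t + d)\<bar> \<le> 1"
    by (rule AE_glue[where P = "\<lambda>t. \<bar>u t\<bar> \<le> 1", OF _ c d cdle])
      (use feas in \<open>auto simp: feasible_process_def\<close>)
  have ac: "absolutely_continuous_on {0..T - d} (\<lambda>t. (if t \<le> c then x t else x (t + d)) i)"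
    if "i \<in> {1..k}" for i
    using absolutely_continuous_on_glue[of T "\<lambda>t. x t i", OF _ c d cdle] feas eq that
    by (simp add: feasible_process_def if_distribR)
  have deriv_lower: "AE t in lebesgue_on {0..T - d}.
      ((\<lambda>s. (if s \<le> c then x s else x (s + d)) i) has_real_derivative
        (if t \<le> c then x t else x (t + d)) (i + 1)) (at t within {0..T - d})" if "i \<in> {1..<k}" for i
  proof -
    have "AE t in lebesgue_on {0..T}. ((\<lambda>s. x s i) has_real_derivative x t (i + 1)) (at t within {0..T})"
      using feas that by (simp add: feasible_process_def)
    from deriv[OF this] show ?thesis by (simp only: if_distribR)
  qed
  show ?thesis
    unfolding feasible_process_def
  proof (intro conjI ballI ac deriv_lower bound borel_measurable_lebesgue_on_glue deriv)
    show "u \<in> borel_measurable (lebesgue_on {0..T})"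
      "AE t in lebesgue_on {0..T}. ((\<lambda>s. x s k) has_real_derivative u t) (at t within {0..T})"
      using feas by (simp_all add: feasible_process_def)
    fix t assume "t \<in> {0..T - d}"
    then show "(if t \<le> c then x t else x (t + d)) 1 \<le> hmax"
      using feas c d cd by (auto simp: feasible_process_def)
  next
    fix i assume "i \<in> {1..k}"
    then show "(if 0 \<le> c then x 0 else x (0 + d)) i = x0 i"
      "(if T - d \<le> c then x (T - d) else x (T - d + d)) i = xT i"
      using feas c cd by (auto simp: feasible_process_def)
  qed (use c d cd in auto)
qed

section \<open>Limit points of the contact set\<close>

lemma feasible_process_continuous_on:
  assumes "feasible_process k hmax x0 xT x u T" "i \<in> {1..k}"
  shows "continuous_on {0..T} (\<lambda>t. x t i)"
  using assms unfolding feasible_process_def by (intro absolutely_continuous_on_imp_continuous_on) simp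

text \<open>For \<open>i < k\<close> the right-hand side is itself a coordinate of the state, hence
  continuous, which upgrades the equation from almost every time to every interior time, as Rolle's
  theorem requires.\<close>

lemma feasible_process_has_derivative:
  assumes feas: "feasible_process k hmax x0 xT x u T" and i: "i \<in> {1..<k}" and t: "t \<in> {0<..<T}"
  shows "((\<lambda>s. x s i) has_real_derivative x t (Suc i)) (at t)"
proof -
  obtain N where N: "negligible N"
    "\<And>t. t \<in> {0..T} - N \<Longrightarrow> ((\<lambda>s. x s i) has_real_derivative x t (Suc i)) (at t within {0..T})"
  proof -
    have "AE t in lebesgue_on {0..T}. ((\<lambda>s. x s i) has_real_derivative x t (Suc i)) (at t within {0..T})"
      using feas i by (simp add: feasible_process_def)
    from iffD1[OF AE_lebesgue_on_Icc_iff_negligible this] show thesis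
      using that by auto
  qed
  have ac: "absolutely_continuous_on {0..T} (\<lambda>s. x s i)"
    using feas i by (simp add: feasible_process_def)
  have cont: "continuous_on {0..T} (\<lambda>t. x t (Suc i))"
    using feas i by (intro feasible_process_continuous_on) auto
  from ac N cont t show ?thesis
    by (rule absolutely_continuous_has_derivative)
qed

text \<open>By closedness \<open>\<sigma>\<close> lies in the level set too. Between
  \<open>\<sigma>\<close> and a nearby point of the level set, Rolle's theorem gives a zero of
  \<open>g\<close> that differs from \<open>\<sigma>\<close> and is still closer to it.\<close>

lemma Rolle_islimpt:
  fixes f :: "real \<Rightarrow> real"
  assumes f: "continuous_on {a..b} f"
    and df: "\<And>t. t \<in> {a<..<b} \<Longrightarrow> (f has_real_derivative g t) (at t)"
    and lim: "\<sigma> islimpt {t\<in>{a..b}. f t = c}"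
  shows "\<sigma> islimpt {t\<in>{a..b}. g t = 0}"
  unfolding islimpt_approachable
proof (intro allI impI)
  fix e :: real assume "e > 0"
  have "closed {t\<in>{a..b}. f t = c}"
    using f by (intro continuous_closed_preimage_constant) auto
  then have \<sigma>: "\<sigma> \<in> {a..b}" "f \<sigma> = c"
    using lim closed_limpt by blast+
  obtain t where t: "t \<in> {a..b}" "f t = c" "t \<noteq> \<sigma>" "dist t \<sigma> < e"
    using lim \<open>e > 0\<close> unfolding islimpt_approachable by blast
  define l r where "l = min t \<sigma>" and "r = max t \<sigma>"
  have lr: "l < r" "{l..r} \<subseteq> {a..b}" "f l = f r"
    using t \<sigma> by (auto simp: l_def r_def min_def max_def)
  have "(f has_real_derivative g z) (at z)" if "l < z" "z < r" for z
    using lr that by (intro df) auto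
  then have "\<exists>z. l < z \<and> z < r \<and> (\<lambda>v. g z * v) = (\<lambda>v. 0)"
    using lr continuous_on_subset[OF f]
    by (intro Rolle_deriv[of l r f "\<lambda>z v. g z * v"]) (auto simp: has_field_derivative_def)
  \<comment> \<open>\<open>Rolle_deriv\<close> yields a vanishing linear map; its value at 1 is
    \<open>g z\<close>.\<close>
  then obtain z where z: "l < z" "z < r" "g z = 0"
    by (metis mult.right_neutral)
  then have "z \<in> {a..b}" "z \<noteq> \<sigma>" "dist z \<sigma> < e"
    using lr t by (auto simp: l_def r_def min_def max_def dist_real_def split: if_splits)
  with z show "\<exists>z\<in>{t \<in> {a..b}. g t = 0}. z \<noteq> \<sigma> \<and> dist z \<sigma> < e" by blast
qed

lemma islimpt_contact_set:
  assumes feas: "feasible_process k hmax x0 xT x u T" and "k \<ge> 1"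
    and lim: "\<sigma> islimpt contact_set hmax x T"
  shows "\<sigma> \<in> stationary_contact_set k hmax x T"
proof -
  \<comment> \<open>The levels of a stationary contact, gathered in one function so that a single
    induction over the coordinates treats \<open>hmax\<close> and 0 alike.\<close>
  define c :: "nat \<Rightarrow> real" where "c i = (if i = 1 then hmax else 0)" for i
  have lim_i: "\<sigma> islimpt {t\<in>{0..T}. x t i = c i}" if "1 \<le> i" "i \<le> k" for i
    using that
  proof (induction i rule: nat_induct_at_least)
    case base
    then show ?case using lim by (simp add: contact_set_def c_def)
  next
    case (Suc i)
    then have i: "i \<in> {1..<k}" by simp
    have "\<sigma> islimpt {t\<in>{0..T}. x t (Suc i) = 0}"
    proof (rule Rolle_islimpt)
      show "continuous_on {0..T} (\<lambda>t. x t i)"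
        using feas i by (intro feasible_process_continuous_on) auto
      show "\<sigma> islimpt {t\<in>{0..T}. x t i = c i}" using Suc by simp
    qed (rule feasible_process_has_derivative[OF feas i])
    then show ?case using Suc by (simp add: c_def)
  qed
  \<comment> \<open>Each level set is closed and therefore contains its limit point.\<close>
  have "\<sigma> \<in> {t\<in>{0..T}. x t i = c i}" if "i \<in> {1..k}" for i
  proof -
    have "closed {t\<in>{0..T}. x t i = c i}"
      using feasible_process_continuous_on[OF feas that]
      by (intro continuous_closed_preimage_constant) auto
    then show ?thesis using lim_i that closed_limpt by auto
  qed
  then show ?thesis
    using \<open>k \<ge> 1\<close> by (fastforce simp: stationary_contact_set_def contact_set_def c_def)
qed

section \<open>Time optimality and the stationary contact\<close>

lemma stationary_contact_set_unique:
  assumes opt: "time_optimal_solution k hmax x0 xT x u T" and fin: "x T 1 < hmax"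
    and "s \<in> stationary_contact_set k hmax x T" "t \<in> stationary_contact_set k hmax x T"
  shows "s = t"
proof -
  \<comment> \<open>The times are bound afresh so that the ordered case can be applied in either
    order.\<close>
  have False if st: "s \<in> stationary_contact_set k hmax x T" "t \<in> stationary_contact_set k hmax x T" "s < t"
    for s t
  proof -
    have feas: "feasible_process k hmax x0 xT x u T"
      using opt by (simp add: time_optimal_solution_def)
    \<comment> \<open>The condition on the final state enters here: excision needs the later time to
      lie strictly before \<open>T\<close>.\<close>
    have "t \<noteq> T" using st fin by (auto simp: stationary_contact_set_def contact_set_def)
    then have "t < T" "0 \<le> s" using st by (auto simp: stationary_contact_set_def contact_set_def)
    have "x s i = x (s + (t - s)) i" if "i \<in> {1..k}" for i
      using st that by (cases "i = 1") (auto simp: stationary_contact_set_def contact_set_def)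
    with feasible_process_excise[OF feas, of s "t - s"] \<open>t < T\<close> \<open>0 \<le> s\<close> st(3) opt
    have "T \<le> T - (t - s)" unfolding time_optimal_solution_def by auto
    with st(3) show False by simp
  qed
  with assms show ?thesis by (meson linorder_neqE_linordered_idom)
qed

section \<open>Structure of the contact set\<close>

lemma compact_contact_set:
  assumes "feasible_process k hmax x0 xT x u T" "k \<ge> 1"
  shows "compact (contact_set hmax x T)"
proof -
  have "closed {t\<in>{0..T}. x t 1 = hmax}"
    using feasible_process_continuous_on[OF assms(1), of 1] assms(2)
    by (intro continuous_closed_preimage_constant) auto
  then have "compact ({0..T} \<inter> {t\<in>{0..T}. x t 1 = hmax})"
    by (intro compact_Int_closed) auto
  moreover have "{0..T} \<inter> {t\<in>{0..T}. x t 1 = hmax} = contact_set hmax x T"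
    by (auto simp: contact_set_def)
  ultimately show ?thesis by simp
qed

text \<open>Bolzano-Weierstrass supplies the limit point \<open>\<sigma>\<close>. By uniqueness all
  other points of \<open>S\<close> are isolated, and a set without limit points in the complement of
  \<open>\<sigma>\<close> has only countably many points there.\<close>

lemma infinite_compact_unique_limit_point:
  fixes S :: "real set"
  assumes S: "compact S" "infinite S" and uniq: "\<And>s t. s islimpt S \<Longrightarrow> t islimpt S \<Longrightarrow> s = t"
  shows "\<exists>S' \<sigma>. S = S' \<union> {\<sigma>} \<and> countable S' \<and> infinite S' \<and>
    (\<forall>t\<in>S'. t isolated_in S) \<and> {t. t islimpt S'} = {\<sigma>}"
proof -
  obtain \<sigma> where \<sigma>: "\<sigma> \<in> S" "\<sigma> islimpt S"
    using S Heine_Borel_imp_Bolzano_Weierstrass by blast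
  \<comment> \<open>Removing a single point does not change the set of limit points.\<close>
  have lim: "t islimpt (S - {\<sigma>}) \<longleftrightarrow> t islimpt S" for t
    using \<sigma>(1) islimpt_insert[of t \<sigma> "S - {\<sigma>}"] by (simp add: insert_absorb)
  have iso: "t isolated_in S" if "t \<in> S - {\<sigma>}" for t
    using that \<sigma> uniq by (auto simp: isolated_in_islimpt_iff)
  \<comment> \<open>The open set \<open>- {\<sigma>}\<close> is itself the required neighbourhood of
    each of its points, since it contains no limit point of \<open>S\<close>.\<close>
  have "S sparse_in - {\<sigma>}"
    unfolding sparse_in_def using \<sigma>(2) uniq by (intro ballI exI[of _ "- {\<sigma>}"]) auto
  then have "countable (- {\<sigma>} \<inter> S)"
    by (intro sparse_imp_countable) auto
  then have "countable (S - {\<sigma>})"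
    by (simp add: Diff_eq Int_commute)
  moreover have "{t. t islimpt (S - {\<sigma>})} = {\<sigma>}"
    unfolding lim using \<sigma> uniq by blast
  ultimately show ?thesis
    using \<sigma>(1) S(2) iso by (intro exI[of _ "S - {\<sigma>}"] exI[of _ \<sigma>]) auto
qed

theorem proposition3:
  fixes k :: nat and hmax :: real and x0 xT :: "nat \<Rightarrow> real"
    and x :: "real \<Rightarrow> nat \<Rightarrow> real" and u :: "real \<Rightarrow> real" and T :: real
  assumes "k \<ge> 1"
    and "time_optimal_solution k hmax x0 xT x u T"
    and "x 0 1 < hmax" and "x T 1 < hmax"
  shows "(finite (contact_set hmax x T) \<or>
      (\<exists>\<Sigma>' \<sigma>. contact_set hmax x T = \<Sigma>' \<union> {\<sigma>} \<and>
        countable \<Sigma>' \<and> infinite \<Sigma>' \<and>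
        (\<forall>t\<in>\<Sigma>'. t isolated_in contact_set hmax x T) \<and>
        {t. t islimpt \<Sigma>'} = {\<sigma>})) \<and>
    (stationary_contact_set k hmax x T = {} \<or>
      (\<exists>\<tau>. stationary_contact_set k hmax x T = {\<tau>}))"
proof
  have feas: "feasible_process k hmax x0 xT x u T"
    using assms(2) by (simp add: time_optimal_solution_def)
  \<comment> \<open>Used twice: for the second claim directly, and for the first through
    \<open>islimpt_contact_set\<close>, which turns two limit points into two stationary
    contacts.\<close>
  note unique = stationary_contact_set_unique[OF assms(2,4)]
  show "finite (contact_set hmax x T) \<or>
      (\<exists>\<Sigma>' \<sigma>. contact_set hmax x T = \<Sigma>' \<union> {\<sigma>} \<and>
        countable \<Sigma>' \<and> infinite \<Sigma>' \<and>
        (\<forall>t\<in>\<Sigma>'. t isolated_in contact_set hmax x T) \<and>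
        {t. t islimpt \<Sigma>'} = {\<sigma>})"
  proof (cases "finite (contact_set hmax x T)")
    case False
    then have "\<exists>\<Sigma>' \<sigma>. contact_set hmax x T = \<Sigma>' \<union> {\<sigma>} \<and>
        countable \<Sigma>' \<and> infinite \<Sigma>' \<and>
        (\<forall>t\<in>\<Sigma>'. t isolated_in contact_set hmax x T) \<and>
        {t. t islimpt \<Sigma>'} = {\<sigma>}"
      by (intro infinite_compact_unique_limit_point compact_contact_set[OF feas assms(1)]
          unique islimpt_contact_set[OF feas assms(1)])
    then show ?thesis ..
  qed simp
  show "stationary_contact_set k hmax x T = {} \<or>
      (\<exists>\<tau>. stationary_contact_set k hmax x T = {\<tau>})"
    using unique by blast
qed

end
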